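(* Let $(M,F)$ be a Finsler manifold with geodesic spray $S$ and $F$-covariant coefficients $H_i$. If an $S$-scalar $H$ exists, then it is of the form $$H=\frac{1}{12}\,y^i\,\partial_iF^2,$$ and this expression is unique up to a function of position only; that is, if $H_1$ is another $S$-scalar, then $H_1-H$ is a function of $x$ only.
   Context: $M$ is an $n$-dimensional smooth manifold, $TM$ its tangent bundle, $\mathcal{T}M=TM\setminus\{0\}$ the slit tangent bundle. $(x^i)$ are local coordinates on $M$ and $(x^i,y^i)$ the induced coordinates on $TM$; $\partial_i:=\frac{\partial}{\partial x^i}$, $\dot{\partial}_i:=\frac{\partial}{\partial y^i}$; the summation convention is used. A Finsler metric is a function $F:TM\to\mathbb{R}$ with $F\ge 0$, $F(x,y)=0$ iff $y=0$, $F$ smooth on $\mathcal{T}M$, $F(x,\lambda y)=\lambda F(x,y)$ for $\lambda>0$, and such that the matrix $g_{ij}:=\frac12\dot{\partial}_i\dot{\partial}_jF^2$ is non-degenerate at each point of $\mathcal{T}M$; $(g^{ij})$ is its inverse. The geodesic spray of $F$ is $S=y^i\partial_i-2G^i\dot{\partial}_i$ with $G^i=\frac14 g^{ih}(y^r\partial_r\dot{\partial}_hF^2-\partial_hF^2)$. The $F$-covariant coefficients of $S$ are $H_i:=g_{ir}G^r=\frac14(y^r\partial_r\dot{\partial}_iF^2-\partial_iF^2)$. If $H_i=\dot{\partial}_iH$ for some $C^\infty$ function $H$ on $\mathcal{T}M$ that is positively $3$-homogeneous in $y$, then $H$ is called an $S$-scalar (spray scalar). The $H_i$ are not components of a tensor;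 the identity $H_i=\dot{\partial}_iH$ is understood in the local coordinates under consideration. *)

theory Defs
  imports "HOL-Analysis.Analysis"
begin

section \<open>Smooth functions on open subsets of normed spaces\<close>

text \<open>Intended for open \<^term>\<open>S\<close> only.\<close>

primrec Ck_on ::
  "nat \<Rightarrow> 'a::real_normed_vector set \<Rightarrow> ('a \<Rightarrow> 'b::real_normed_vector) \<Rightarrow> bool" where
  "Ck_on 0 S f \<longleftrightarrow> continuous_on S f"
| "Ck_on (Suc k) S f \<longleftrightarrow>
     (\<forall>x\<in>S. f differentiable (at x)) \<and>
     (\<forall>v. Ck_on k S (\<lambda>x. frechet_derivative f (at x) v))"

definition smooth_on ::
  "'a::real_normed_vector set \<Rightarrow> ('a \<Rightarrow> 'b::real_normed_vector) \<Rightarrow> bool" where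
  "smooth_on S f \<longleftrightarrow> (\<forall>k. Ck_on k S f)"

section \<open>Smooth manifolds\<close>

text \<open>A chart is a pair of its domain and its coordinate map; the values of the map outside
  the domain are irrelevant.\<close>

type_synonym ('m, 'n) chart = "'m set \<times> ('m \<Rightarrow> real ^ 'n)"

definition is_chart :: "'m topology \<Rightarrow> ('m, 'n::finite) chart \<Rightarrow> bool" where
  "is_chart X c \<longleftrightarrow>
     openin X (fst c) \<and> open (snd c ` fst c) \<and>
     homeomorphic_map (subtopology X (fst c)) (top_of_set (snd c ` fst c)) (snd c)"

definition transition ::
  "('m, 'n::finite) chart \<Rightarrow> ('m, 'n) chart \<Rightarrow> real ^ 'n \<Rightarrow> real ^ 'n" where
  "transition c d = snd d \<circ> inv_into (fst c) (snd c)"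

text \<open>The atlas need not be maximal; taking it maximal, its members are all the local
  coordinate systems of the manifold.\<close>

definition smooth_manifold :: "'m topology \<Rightarrow> ('m, 'n::finite) chart set \<Rightarrow> bool" where
  "smooth_manifold X A \<longleftrightarrow>
     Hausdorff_space X \<and> second_countable X \<and>
     (\<forall>c\<in>A. is_chart X c) \<and> (\<Union>c\<in>A. fst c) = topspace X \<and>
     (\<forall>c\<in>A. \<forall>d\<in>A. smooth_on (snd c ` (fst c \<inter> fst d)) (transition c d))"

section \<open>The tangent bundle\<close>

text \<open>A tangent vector at a point is the family of its component vectors in all the charts
  around that point, related by the usual transformation law
  (derivative of the transition map).  At all other pairs of sets and
  maps the family is set to 0, so that equality of functions is equality of tangent vectors.\<close>

type_synonym ('m, 'n) tangent = "('m, 'n) chart \<Rightarrow> real ^ 'n"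

definition tangent_space ::
  "('m, 'n::finite) chart set \<Rightarrow> 'm \<Rightarrow> ('m, 'n) tangent set" where
  "tangent_space A p =
     {v. (\<forall>c\<in>A. \<forall>d\<in>A. p \<in> fst c \<longrightarrow> p \<in> fst d \<longrightarrow>
            v d = frechet_derivative (transition c d) (at (snd c p)) (v c)) \<and>
         (\<forall>c. \<not> (c \<in> A \<and> p \<in> fst c) \<longrightarrow> v c = 0)}"

text \<open>The restriction of the tangent bundle to a set \<^term>\<open>U\<close> of points.\<close>

definition tangent_bundle ::
  "('m, 'n::finite) chart set \<Rightarrow> 'm set \<Rightarrow> ('m \<times> ('m, 'n) tangent) set" where
  "tangent_bundle A U = (SIGMA p:U. tangent_space A p)"

definition slit_tangent_bundle ::
  "('m, 'n::finite) chart set \<Rightarrow> 'm set \<Rightarrow> ('m \<times> ('m, 'n) tangent) set" where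
  "slit_tangent_bundle A U = {(p, v) \<in> tangent_bundle A U. v \<noteq> (\<lambda>_. 0)}"

text \<open>The coordinates \<open>(x, y)\<close> on the tangent bundle induced by a chart.\<close>

definition induced_coords ::
  "('m, 'n::finite) chart \<Rightarrow> 'm \<times> ('m, 'n) tangent \<Rightarrow> (real ^ 'n) \<times> (real ^ 'n)" where
  "induced_coords c = (\<lambda>(p, v). (snd c p, v c))"

definition coord_rep ::
  "('m, 'n::finite) chart set \<Rightarrow> ('m, 'n) chart \<Rightarrow> ('m \<times> ('m, 'n) tangent \<Rightarrow> real) \<Rightarrow>
     (real ^ 'n) \<times> (real ^ 'n) \<Rightarrow> real" where
  "coord_rep A c f = f \<circ> inv_into (tangent_bundle A (fst c)) (induced_coords c)"

definition slit_coord_domain :: "('m, 'n::finite) chart \<Rightarrow> ((real ^ 'n) \<times> (real ^ 'n)) set" where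
  "slit_coord_domain c = (snd c ` fst c) \<times> (UNIV - {0})"

definition smooth_on_slit ::
  "('m, 'n::finite) chart set \<Rightarrow> ('m \<times> ('m, 'n) tangent \<Rightarrow> real) \<Rightarrow> bool" where
  "smooth_on_slit A f \<longleftrightarrow> (\<forall>c\<in>A. smooth_on (slit_coord_domain c) (coord_rep A c f))"

text \<open>The coordinate derivations with respect to \<open>x\<^sup>i\<close> and \<open>y\<^sup>i\<close>.\<close>

definition dx :: "'n \<Rightarrow> ((real ^ 'n::finite) \<times> (real ^ 'n) \<Rightarrow> real) \<Rightarrow>
    (real ^ 'n) \<times> (real ^ 'n) \<Rightarrow> real" where
  "dx i f = (\<lambda>(x, y). deriv (\<lambda>t. f (x + t *\<^sub>R axis i 1, y)) 0)"

definition dy :: "'n \<Rightarrow> ((real ^ 'n::finite) \<times> (real ^ 'n) \<Rightarrow> real) \<Rightarrow>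
    (real ^ 'n) \<times> (real ^ 'n) \<Rightarrow> real" where
  "dy i f = (\<lambda>(x, y). deriv (\<lambda>t. f (x, y + t *\<^sub>R axis i 1)) 0)"

section \<open>Finsler metrics and spray scalars\<close>

definition metric_matrix ::
  "('m, 'n::finite) chart set \<Rightarrow> ('m, 'n) chart \<Rightarrow> ('m \<times> ('m, 'n) tangent \<Rightarrow> real) \<Rightarrow>
     (real ^ 'n) \<times> (real ^ 'n) \<Rightarrow> real ^ 'n ^ 'n" where
  "metric_matrix A c F z =
     (\<chi> i j. 1/2 * dy i (dy j (\<lambda>w. (coord_rep A c F w)\<^sup>2)) z)"

text \<open>Homogeneity of degree \<^term>\<open>k\<close> under positive factors, over a set \<^term>\<open>E\<close> of pairs of
  points and tangent vectors.\<close>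

definition pos_homogeneous ::
  "nat \<Rightarrow> ('m \<times> ('m, 'n::finite) tangent) set \<Rightarrow> ('m \<times> ('m, 'n) tangent \<Rightarrow> real) \<Rightarrow> bool" where
  "pos_homogeneous k E f \<longleftrightarrow>
     (\<forall>(p, v)\<in>E. \<forall>r>0. f (p, \<lambda>c. r *\<^sub>R v c) = r ^ k * f (p, v))"

definition finsler_metric ::
  "'m topology \<Rightarrow> ('m, 'n::finite) chart set \<Rightarrow> ('m \<times> ('m, 'n) tangent \<Rightarrow> real) \<Rightarrow> bool" where
  "finsler_metric X A F \<longleftrightarrow>
     (\<forall>(p, v)\<in>tangent_bundle A (topspace X).
        F (p, v) \<ge> 0 \<and> (F (p, v) = 0 \<longleftrightarrow> v = (\<lambda>_. 0))) \<and>
     smooth_on_slit A F \<and>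
     pos_homogeneous 1 (tangent_bundle A (topspace X)) F \<and>
     (\<forall>c\<in>A. \<forall>z\<in>slit_coord_domain c. invertible (metric_matrix A c F z))"

text \<open>The coefficients \<open>G\<^sup>i\<close> of the geodesic spray
  \<open>S = y\<^sup>i \<partial>/\<partial>x\<^sup>i - 2 G\<^sup>i \<partial>/\<partial>y\<^sup>i\<close> of \<^term>\<open>F\<close>.\<close>

definition geodesic_spray_coeff ::
  "('m, 'n::finite) chart set \<Rightarrow> ('m, 'n) chart \<Rightarrow> ('m \<times> ('m, 'n) tangent \<Rightarrow> real) \<Rightarrow>
     'n \<Rightarrow> (real ^ 'n) \<times> (real ^ 'n) \<Rightarrow> real" where
  "geodesic_spray_coeff A c F i z =
     (let F2 = (\<lambda>w. (coord_rep A c F w)\<^sup>2) in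
      1/4 * (\<Sum>h\<in>UNIV. matrix_inv (metric_matrix A c F z) $ i $ h *
        ((\<Sum>r\<in>UNIV. snd z $ r * dx r (dy h F2) z) - dx h F2 z)))"

definition covariant_spray_coeff ::
  "('m, 'n::finite) chart set \<Rightarrow> ('m, 'n) chart \<Rightarrow> ('m \<times> ('m, 'n) tangent \<Rightarrow> real) \<Rightarrow>
     'n \<Rightarrow> (real ^ 'n) \<times> (real ^ 'n) \<Rightarrow> real" where
  "covariant_spray_coeff A c F i z =
     (\<Sum>r\<in>UNIV. metric_matrix A c F z $ i $ r * geodesic_spray_coeff A c F r z)"

text \<open>The covariant coefficients are not components of a tensor, so the notion of a spray
  scalar refers to the local coordinates \<^term>\<open>c\<close> in which they are computed.\<close>

definition spray_scalar ::
  "'m topology \<Rightarrow> ('m, 'n::finite) chart set \<Rightarrow> ('m \<times> ('m, 'n) tangent \<Rightarrow> real) \<Rightarrow>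
     ('m, 'n) chart \<Rightarrow> ('m \<times> ('m, 'n) tangent \<Rightarrow> real) \<Rightarrow> bool" where
  "spray_scalar X A F c H \<longleftrightarrow>
     smooth_on_slit A H \<and>
     pos_homogeneous 3 (slit_tangent_bundle A (topspace X)) H \<and>
     (\<forall>z\<in>slit_coord_domain c. \<forall>i. covariant_spray_coeff A c F i z = dy i (coord_rep A c H) z)"

end

theory Submission
  imports Defs
begin

text \<open>Contract the identity \<open>4 H\<^sub>i = y\<^sup>r \<partial>\<^sub>r \<partial>\<^sub>y\<^sub>i F\<^sup>2 - \<partial>\<^sub>i F\<^sup>2\<close> with \<open>y\<^sup>i\<close>.  Since \<open>H\<^sub>i\<close> is the
  fibre derivative of the 3-homogeneous function \<open>H\<close>, Euler's theorem turns the left-hand side into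
  \<open>12 H\<close>.  On the right, \<open>y\<^sup>i\<close> does not depend on \<open>x\<close> and may be moved under \<open>\<partial>\<^sub>r\<close>, and Euler's theorem
  for the 2-homogeneous function \<open>F\<^sup>2\<close> gives
  \<open>y\<^sup>r \<partial>\<^sub>r (y\<^sup>i \<partial>\<^sub>y\<^sub>i F\<^sup>2) - y\<^sup>i \<partial>\<^sub>i F\<^sup>2 = 2 y\<^sup>r \<partial>\<^sub>r F\<^sup>2 - y\<^sup>i \<partial>\<^sub>i F\<^sup>2 = y\<^sup>i \<partial>\<^sub>i F\<^sup>2\<close>.
  Hence \<open>H\<close> is determined by \<open>F\<close>, and two spray scalars even coincide.

  Both uses of Euler's theorem are made in the coordinates of a chart, and the second one at all
  base points near the given one.  Homogeneity is given on the tangent bundle, so it has to be known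
  that the induced coordinates are a bijection of the bundle over the chart onto an open set times
  the full vector space, and that they commute with scaling; this is
  \<open>bij_betw_induced_coords\<close> and \<open>coord_rep_homogeneous\<close>.  The analytic core is
  \<open>euler_homogeneous\<close> and \<open>contracted_mixed_derivative\<close>; \<open>spray_scalar_formula\<close> combines them.\<close>

section \<open>Charts and transition maps\<close>

lemma inj_on_chart:
  assumes "is_chart X c"
  shows "inj_on (snd c) (fst c)"
proof -
  have "inj_on (snd c) (topspace (subtopology X (fst c)))"
    using assms unfolding is_chart_def by (metis homeomorphic_imp_injective_map)
  moreover have "topspace (subtopology X (fst c)) = fst c"
    using assms openin_subset unfolding is_chart_def by fastforce
  ultimately show ?thesis by simp
qed

lemma open_chart_image:
  assumes "is_chart X c" and "openin X V"
  shows "open (snd c ` (fst c \<inter> V))"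
proof -
  have "open_map (subtopology X (fst c)) (top_of_set (snd c ` fst c)) (snd c)"
    using assms unfolding is_chart_def by (metis homeomorphic_imp_open_map)
  moreover have "openin (subtopology X (fst c)) (fst c \<inter> V)"
    using assms(2) by (simp add: openin_subtopology_Int2)
  ultimately have "openin (top_of_set (snd c ` fst c)) (snd c ` (fst c \<inter> V))"
    unfolding open_map_def by blast
  then show ?thesis
    using assms(1) unfolding is_chart_def by (metis openin_open_trans)
qed

lemma transition_chart:
  assumes "is_chart X c" and "p \<in> fst c"
  shows "transition c d (snd c p) = snd d p"
  using inj_on_chart[OF assms(1)] assms(2) by (simp add: transition_def)

lemma smooth_on_differentiable:
  assumes "smooth_on S f" and "x \<in> S"
  shows "f differentiable (at x)"
proof -
  have "Ck_on (Suc 0) S f" using assms(1) unfolding smooth_on_def by blast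
  then show ?thesis using assms(2) by simp
qed

lemma smooth_on_differentiable_derivative:
  assumes "smooth_on S f" and "x \<in> S"
  shows "(\<lambda>x. frechet_derivative f (at x) v) differentiable (at x)"
proof -
  have "Ck_on (Suc (Suc 0)) S f" using assms(1) unfolding smooth_on_def by blast
  then show ?thesis using assms(2) by simp
qed

lemma is_chart_atlas:
  assumes "smooth_manifold X A" and "c \<in> A"
  shows "is_chart X c"
  using assms unfolding smooth_manifold_def by blast

lemma transition_differentiable:
  assumes "smooth_manifold X A" and "c \<in> A" "d \<in> A" and "p \<in> fst c" "p \<in> fst d"
  shows "transition c d differentiable (at (snd c p))"
proof (rule smooth_on_differentiable)
  show "smooth_on (snd c ` (fst c \<inter> fst d)) (transition c d)"
    using assms unfolding smooth_manifold_def by blast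
qed (use assms in blast)

lemma linear_transition_derivative:
  assumes "smooth_manifold X A" and "c \<in> A" "d \<in> A" and "p \<in> fst c" "p \<in> fst d"
  shows "linear (frechet_derivative (transition c d) (at (snd c p)))"
  using linear_frechet_derivative[OF transition_differentiable[OF assms]] .

text \<open>The chain rule for \<open>\<tau>\<^sub>c\<^sub>e = \<tau>\<^sub>d\<^sub>e \<circ> \<tau>\<^sub>c\<^sub>d\<close>, which holds on the open coordinate image of the triple
  overlap.\<close>

lemma transition_derivative_cocycle:
  assumes M: "smooth_manifold X A" and A: "c \<in> A" "d \<in> A" "e \<in> A"
    and p: "p \<in> fst c" "p \<in> fst d" "p \<in> fst e"
  shows "frechet_derivative (transition c e) (at (snd c p)) y =
    frechet_derivative (transition d e) (at (snd d p))
      (frechet_derivative (transition c d) (at (snd c p)) y)"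
proof -
  note ch = is_chart_atlas[OF M]
  let ?W = "snd c ` (fst c \<inter> (fst d \<inter> fst e))"
  have "openin X (fst d \<inter> fst e)"
    using ch[OF A(2)] ch[OF A(3)] unfolding is_chart_def by blast
  then have W: "open ?W" by (rule open_chart_image[OF ch[OF A(1)]])
  have 1: "(transition c d has_derivative frechet_derivative (transition c d) (at (snd c p)))
      (at (snd c p))"
    using transition_differentiable[OF M A(1,2) p(1,2)] frechet_derivative_works by blast
  have 2: "(transition d e has_derivative frechet_derivative (transition d e) (at (snd d p)))
      (at (transition c d (snd c p)))"
    using frechet_derivative_works[THEN iffD1, OF transition_differentiable[OF M A(2,3) p(2,3)]]
    by (simp add: transition_chart[OF ch[OF A(1)] p(1)])
  have "(transition c e has_derivative
      (frechet_derivative (transition d e) (at (snd d p)) \<circ>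
       frechet_derivative (transition c d) (at (snd c p)))) (at (snd c p))"
  proof (rule has_derivative_transform_within_open[OF diff_chain_at[OF 1 2] W])
    show "snd c p \<in> ?W" using p by blast
    show "(transition d e \<circ> transition c d) x = transition c e x" if "x \<in> ?W" for x
      using that by (auto simp: transition_chart[OF ch[OF A(1)]] transition_chart[OF ch[OF A(2)]])
  qed
  from frechet_derivative_at[OF this] show ?thesis by (metis comp_apply)
qed

lemma transition_derivative_refl:
  assumes M: "smooth_manifold X A" and c: "c \<in> A" and p: "p \<in> fst c"
  shows "frechet_derivative (transition c c) (at (snd c p)) y = y"
proof -
  note ch = is_chart_atlas[OF M c]
  have W: "open (snd c ` fst c)" using ch unfolding is_chart_def by blast
  have "(transition c c has_derivative (\<lambda>x. x)) (at (snd c p))"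
    by (rule has_derivative_transform_within_open[OF has_derivative_ident W])
      (use p in \<open>auto simp: transition_chart[OF ch]\<close>)
  from frechet_derivative_at[OF this] show ?thesis by metis
qed

section \<open>Induced coordinates on the tangent bundle\<close>

lemma tangent_space_transform:
  assumes "v \<in> tangent_space A p" "c \<in> A" "d \<in> A" "p \<in> fst c" "p \<in> fst d"
  shows "v d = frechet_derivative (transition c d) (at (snd c p)) (v c)"
  using assms unfolding tangent_space_def by blast

lemma tangent_space_outside:
  assumes "v \<in> tangent_space A p" "\<not> (d \<in> A \<and> p \<in> fst d)"
  shows "v d = 0"
  using assms unfolding tangent_space_def by blast

lemma tangent_vector_eqI:
  assumes v: "v \<in> tangent_space A p" "w \<in> tangent_space A p"
    and c: "c \<in> A" "p \<in> fst c" and eq: "v c = w c"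
  shows "v = w"
proof
  fix d
  show "v d = w d"
  proof (cases "d \<in> A \<and> p \<in> fst d")
    case True
    then show ?thesis
      using tangent_space_transform[of v A p c d] tangent_space_transform[of w A p c d] assms by simp
  next
    case False
    then show ?thesis using tangent_space_outside v by metis
  qed
qed

text \<open>Components prescribed in one chart extend to a tangent vector: transport them to every other
  chart by the derivative of the transition map; the cocycle rule is the required compatibility.\<close>

lemma tangent_vector_exists:
  assumes M: "smooth_manifold X A" and c: "c \<in> A" and p: "p \<in> fst c"
  shows "\<exists>v\<in>tangent_space A p. v c = y"
proof -
  define v where "v = (\<lambda>d. if d \<in> A \<and> p \<in> fst d
    then frechet_derivative (transition c d) (at (snd c p)) y else 0)"
  have "v \<in> tangent_space A p"
    unfolding tangent_space_def
  proof (intro CollectI conjI ballI impI allI)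
    fix d e assume "d \<in> A" "e \<in> A" "p \<in> fst d" "p \<in> fst e"
    then show "v e = frechet_derivative (transition d e) (at (snd d p)) (v d)"
      using transition_derivative_cocycle[OF M c _ _ p, of d e y]
      by (simp only: v_def simp_thms if_True)
  qed (simp only: v_def if_False)
  moreover have "v c = y"
    using transition_derivative_refl[OF M c p] c p by (simp add: v_def)
  ultimately show ?thesis by blast
qed

lemma tangent_space_scaleR:
  assumes M: "smooth_manifold X A" and v: "v \<in> tangent_space A p"
  shows "(\<lambda>d. r *\<^sub>R v d) \<in> tangent_space A p"
  unfolding tangent_space_def
proof (intro CollectI conjI ballI impI allI)
  fix d e assume *: "d \<in> A" "e \<in> A" "p \<in> fst d" "p \<in> fst e"
  show "r *\<^sub>R v e = frechet_derivative (transition d e) (at (snd d p)) (r *\<^sub>R v d)"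
    using tangent_space_transform[OF v *]
      linear_scale[OF linear_transition_derivative[OF M *]] by simp
next
  fix d assume "\<not> (d \<in> A \<and> p \<in> fst d)"
  then show "r *\<^sub>R v d = 0" using tangent_space_outside[OF v] by simp
qed

lemma tangent_vector_zero_iff:
  assumes M: "smooth_manifold X A" and v: "v \<in> tangent_space A p" and c: "c \<in> A" "p \<in> fst c"
  shows "v c = 0 \<longleftrightarrow> v = (\<lambda>_. 0)"
proof
  assume "v c = 0"
  \<comment> \<open>The zero family is \<open>0\<close> times \<open>v\<close>, hence a tangent vector.\<close>
  moreover have "(\<lambda>_. 0) \<in> tangent_space A p" using tangent_space_scaleR[OF M v, of 0] by simp
  ultimately show "v = (\<lambda>_. 0)" using tangent_vector_eqI[OF v _ c] by simp
qed simp

lemma bij_betw_induced_coords: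
  assumes M: "smooth_manifold X A" and c: "c \<in> A"
  shows "bij_betw (induced_coords c) (tangent_bundle A (fst c)) ((snd c ` fst c) \<times> UNIV)"
  unfolding bij_betw_def
proof
  show "inj_on (induced_coords c) (tangent_bundle A (fst c))"
  proof (rule inj_onI, clarify)
    fix p v q w
    assume pv: "(p, v) \<in> tangent_bundle A (fst c)" and qw: "(q, w) \<in> tangent_bundle A (fst c)"
      and eq: "induced_coords c (p, v) = induced_coords c (q, w)"
    have "p = q"
      using inj_onD[OF inj_on_chart[OF is_chart_atlas[OF M c]]] pv qw eq
      by (auto simp: tangent_bundle_def induced_coords_def)
    moreover have "v = w"
      using tangent_vector_eqI[OF _ _ c] pv qw eq \<open>p = q\<close>
      by (auto simp: tangent_bundle_def induced_coords_def)
    ultimately show "p = q \<and> v = w" ..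
  qed
  show "induced_coords c ` tangent_bundle A (fst c) = (snd c ` fst c) \<times> UNIV"
  proof
    show "(snd c ` fst c) \<times> UNIV \<subseteq> induced_coords c ` tangent_bundle A (fst c)"
    proof clarify
      fix p y assume p: "p \<in> fst c"
      then obtain v where "v \<in> tangent_space A p" "v c = y"
        using tangent_vector_exists[OF M c] by blast
      then show "(snd c p, y) \<in> induced_coords c ` tangent_bundle A (fst c)"
        using p by (force simp: tangent_bundle_def induced_coords_def)
    qed
  qed (auto simp: tangent_bundle_def induced_coords_def)
qed

lemma coord_rep_induced_coords:
  assumes "smooth_manifold X A" "c \<in> A" "w \<in> tangent_bundle A (fst c)"
  shows "coord_rep A c f (induced_coords c w) = f w"
  using bij_betw_induced_coords[OF assms(1,2)] assms(3)
  by (simp add: coord_rep_def bij_betw_def inv_into_f_f)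

lemma induced_coords_slit:
  assumes M: "smooth_manifold X A" and c: "c \<in> A" and w: "w \<in> slit_tangent_bundle A (fst c)"
  shows "w \<in> tangent_bundle A (fst c)" "induced_coords c w \<in> slit_coord_domain c"
proof -
  show "w \<in> tangent_bundle A (fst c)"
    using w by (auto simp: slit_tangent_bundle_def)
  obtain p v where "w = (p, v)" "p \<in> fst c" "v \<in> tangent_space A p" "v \<noteq> (\<lambda>_. 0)"
    using w by (auto simp: slit_tangent_bundle_def tangent_bundle_def)
  then show "induced_coords c w \<in> slit_coord_domain c"
    using tangent_vector_zero_iff[OF M _ c]
    by (auto simp: slit_coord_domain_def induced_coords_def)
qed

lemma coord_rep_homogeneous:
  assumes M: "smooth_manifold X A" and c: "c \<in> A"
    and hom: "pos_homogeneous k (slit_tangent_bundle A (topspace X)) f"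
    and z: "(x, y) \<in> slit_coord_domain c" and r: "r > 0"
  shows "coord_rep A c f (x, r *\<^sub>R y) = r ^ k * coord_rep A c f (x, y)"
proof -
  obtain p where p: "p \<in> fst c" "x = snd c p" and y: "y \<noteq> 0"
    using z by (auto simp: slit_coord_domain_def)
  obtain v where v: "v \<in> tangent_space A p" "v c = y"
    using tangent_vector_exists[OF M c p(1)] by blast
  have "p \<in> topspace X" using M c p(1) unfolding smooth_manifold_def by blast
  then have "(p, v) \<in> slit_tangent_bundle A (topspace X)"
    using v y by (auto simp: slit_tangent_bundle_def tangent_bundle_def)
  then have h: "f (p, \<lambda>c. r *\<^sub>R v c) = r ^ k * f (p, v)"
    using hom r unfolding pos_homogeneous_def by fast
  have 1: "coord_rep A c f (x, y) = f (p, v)"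
    using coord_rep_induced_coords[OF M c, of "(p, v)" f] v p
    by (simp add: tangent_bundle_def induced_coords_def)
  have "coord_rep A c f (x, r *\<^sub>R y) = f (p, \<lambda>c. r *\<^sub>R v c)"
    using coord_rep_induced_coords[OF M c, of "(p, \<lambda>c. r *\<^sub>R v c)" f] v p
      tangent_space_scaleR[OF M v(1)]
    by (simp add: tangent_bundle_def induced_coords_def)
  with h 1 show ?thesis by simp
qed

lemma open_slit_coord_domain:
  assumes "is_chart X c"
  shows "open (slit_coord_domain c)"
  using assms unfolding slit_coord_domain_def is_chart_def
  by (intro open_Times) (auto simp: open_delete)

section \<open>Coordinate derivations and Euler's theorem\<close>

lemma DERIV_along_line:
  fixes f :: "'a::real_normed_vector \<Rightarrow> real"
  assumes "f differentiable (at z)"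
  shows "((\<lambda>t. f (z + t *\<^sub>R u)) has_real_derivative frechet_derivative f (at z) u) (at 0)"
proof -
  have f: "(f has_derivative frechet_derivative f (at z)) (at (z + 0 *\<^sub>R u))"
    using frechet_derivative_works[THEN iffD1, OF assms] by simp
  have "((\<lambda>t. z + t *\<^sub>R u) has_derivative (\<lambda>t. t *\<^sub>R u)) (at 0)"
    by (auto intro!: derivative_eq_intros)
  from diff_chain_at[OF this f] show ?thesis
    using linear_scale[OF linear_frechet_derivative[OF assms]]
    by (simp add: has_field_derivative_def o_def mult.commute[of _ "frechet_derivative f (at z) u"]
        mult_commute_abs)
qed

lemma DERIV_dx:
  assumes "f differentiable (at (x, y))"
  shows "((\<lambda>t. f (x + t *\<^sub>R axis i 1, y)) has_real_derivative dx i f (x, y)) (at 0)"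
  using DERIV_along_line[OF assms, of "(axis i 1, 0)"] DERIV_imp_deriv[of _ _ "0::real"]
  by (fastforce simp: dx_def)

lemma dy_eq_frechet_derivative:
  assumes "f differentiable (at z)"
  shows "dy i f z = frechet_derivative f (at z) (0, axis i 1)"
  using DERIV_imp_deriv[OF DERIV_along_line[OF assms, of "(0, axis i 1)"]]
  by (cases z) (simp add: dy_def)

lemma sum_dy_eq_frechet_derivative:
  fixes f :: "(real ^ 'n::finite) \<times> (real ^ 'n) \<Rightarrow> real"
  assumes "f differentiable (at z)"
  shows "(\<Sum>i\<in>UNIV. v $ i * dy i f z) = frechet_derivative f (at z) (0, v)"
proof -
  note lin = linear_frechet_derivative[OF assms]
  have "(0, v) = (\<Sum>i\<in>UNIV. v $ i *\<^sub>R ((0, axis i 1) :: (real ^ 'n) \<times> (real ^ 'n)))"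
    using basis_expansion[of v] by (simp add: prod_eq_iff fst_sum snd_sum scalar_mult_eq_scaleR)
  then show ?thesis
    by (simp add: linear_sum[OF lin] linear_scale[OF lin] dy_eq_frechet_derivative[OF assms]
        del: scaleR_Pair)
qed

text \<open>Differentiate \<open>f (x, r y) = r\<^sup>k f (x, y)\<close> with respect to \<open>r\<close> at \<open>r = 1\<close>.\<close>

lemma euler_homogeneous:
  fixes f :: "(real ^ 'n::finite) \<times> (real ^ 'n) \<Rightarrow> real"
  assumes diff: "f differentiable (at (x, y))"
    and hom: "\<And>r. r > 0 \<Longrightarrow> f (x, r *\<^sub>R y) = r ^ k * f (x, y)"
  shows "(\<Sum>i\<in>UNIV. y $ i * dy i f (x, y)) = k * f (x, y)"
proof -
  have 1: "((\<lambda>t. f (x, (1 + t) *\<^sub>R y)) has_real_derivative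
      frechet_derivative f (at (x, y)) (0, y)) (at 0)"
    using DERIV_along_line[OF diff, of "(0, y)"] by (simp add: scaleR_add_left)
  have "((\<lambda>t. (1 + t) ^ k * f (x, y)) has_real_derivative k * f (x, y)) (at 0)"
    by (auto intro!: derivative_eq_intros)
  then have "((\<lambda>t. f (x, (1 + t) *\<^sub>R y)) has_real_derivative k * f (x, y)) (at 0)"
    by (rule has_field_derivative_transform_within_open[where S = "{-1<..}"]) (auto simp: hom)
  with 1 have "frechet_derivative f (at (x, y)) (0, y) = k * f (x, y)"
    by (rule DERIV_unique)
  then show ?thesis by (simp add: sum_dy_eq_frechet_derivative[OF diff])
qed

text \<open>Euler's identity \<open>y\<^sup>i \<partial>\<^sub>y\<^sub>i E = k E\<close> may be differentiated along the base because it holds at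
  all base points near \<open>x\<close>; the coefficients \<open>y\<^sup>i\<close> are constant in this direction.\<close>

lemma contracted_mixed_derivative:
  fixes E :: "(real ^ 'n::finite) \<times> (real ^ 'n) \<Rightarrow> real"
  assumes S: "open S" and z: "(x, y) \<in> S"
    and diff: "\<And>w. w \<in> S \<Longrightarrow> E differentiable (at w)"
    and diff2: "\<And>i. dy i E differentiable (at (x, y))"
    and hom: "\<And>x y r. (x, y) \<in> S \<Longrightarrow> r > 0 \<Longrightarrow> E (x, r *\<^sub>R y) = r ^ k * E (x, y)"
  shows "(\<Sum>i\<in>UNIV. y $ i * dx r (dy i E) (x, y)) = k * dx r E (x, y)"
proof -
  let ?g = "\<lambda>t::real. (x + t *\<^sub>R axis r 1, y)"
  have 1: "((\<lambda>t. \<Sum>i\<in>UNIV. y $ i * dy i E (?g t)) has_real_derivative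
      (\<Sum>i\<in>UNIV. y $ i * dx r (dy i E) (x, y))) (at 0)"
    by (intro DERIV_sum DERIV_cmult DERIV_dx diff2)
  have 2: "((\<lambda>t. k * E (?g t)) has_real_derivative k * dx r E (x, y)) (at 0)"
    by (intro DERIV_cmult DERIV_dx diff z)
  have U: "open (?g -` S)"
    by (intro open_vimage S continuous_intros)
  have "((\<lambda>t. \<Sum>i\<in>UNIV. y $ i * dy i E (?g t)) has_real_derivative k * dx r E (x, y)) (at 0)"
  proof (rule has_field_derivative_transform_within_open[OF 2 U])
    show "0 \<in> ?g -` S" using z by simp
    fix t assume "t \<in> ?g -` S"
    then have t: "?g t \<in> S" by simp
    then show "k * E (?g t) = (\<Sum>i\<in>UNIV. y $ i * dy i E (?g t))"
      using euler_homogeneous[OF diff[OF t] hom[OF t]] by simp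
  qed
  with 1 show ?thesis by (rule DERIV_unique)
qed

text \<open>The fibre derivatives of the square of a smooth function are again differentiable, by
  \<open>\<partial>\<^sub>y\<^sub>i f\<^sup>2 = 2 f \<partial>\<^sub>y\<^sub>i f\<close>.\<close>

lemma differentiable_dy_square:
  fixes f :: "(real ^ 'n::finite) \<times> (real ^ 'n) \<Rightarrow> real"
  assumes S: "open S" and f: "smooth_on S f" and z: "z \<in> S"
  shows "(\<lambda>w. (f w)\<^sup>2) differentiable (at z)"
    and "dy i (\<lambda>w. (f w)\<^sup>2) differentiable (at z)"
proof -
  let ?D = "\<lambda>w. frechet_derivative f (at w)"
  have sq: "((\<lambda>w. (f w)\<^sup>2) has_derivative (\<lambda>v. 2 * f w * ?D w v)) (at w)" if "w \<in> S" for w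
  proof -
    have "(f has_derivative ?D w) (at w)"
      using smooth_on_differentiable[OF f that] frechet_derivative_works by blast
    then show ?thesis
      by (auto intro!: derivative_eq_intros)
  qed
  show "(\<lambda>w. (f w)\<^sup>2) differentiable (at z)"
    using sq[OF z] unfolding differentiable_def by blast
  have eq: "2 * f w * ?D w (0, axis i 1) = dy i (\<lambda>w. (f w)\<^sup>2) w" if "w \<in> S" for w
  proof -
    have "(\<lambda>w. (f w)\<^sup>2) differentiable (at w)"
      using sq[OF that] unfolding differentiable_def by blast
    then show ?thesis
      using dy_eq_frechet_derivative frechet_derivative_at[OF sq[OF that]] by metis
  qed
  have "(\<lambda>w. 2 * f w * ?D w (0, axis i 1)) differentiable (at z)"
    by (intro differentiable_mult differentiable_const smooth_on_differentiable[OF f z]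
        smooth_on_differentiable_derivative[OF f z])
  then obtain D where "((\<lambda>w. 2 * f w * ?D w (0, axis i 1)) has_derivative D) (at z)"
    unfolding differentiable_def by blast
  then have "(dy i (\<lambda>w. (f w)\<^sup>2) has_derivative D) (at z)"
    by (rule has_derivative_transform_within_open[OF _ S z]) (rule eq)
  then show "dy i (\<lambda>w. (f w)\<^sup>2) differentiable (at z)"
    unfolding differentiable_def by blast
qed

section \<open>Spray scalars\<close>

text \<open>Lowering the index of \<open>G\<^sup>i\<close> undoes the inverse metric in its definition.\<close>

lemma covariant_spray_coeff_eq:
  assumes "invertible (metric_matrix A c F z)"
  shows "covariant_spray_coeff A c F i z =
    1/4 * ((\<Sum>r\<in>UNIV. snd z $ r * dx r (dy i (\<lambda>w. (coord_rep A c F w)\<^sup>2)) z)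
      - dx i (\<lambda>w. (coord_rep A c F w)\<^sup>2) z)"
proof -
  let ?M = "metric_matrix A c F z"
  let ?E = "\<lambda>w. (coord_rep A c F w)\<^sup>2"
  define b where "b = (\<chi> h. (\<Sum>r\<in>UNIV. snd z $ r * dx r (dy h ?E) z) - dx h ?E z)"
  have "geodesic_spray_coeff A c F r z = 1/4 * (matrix_inv ?M *v b) $ r" for r
    by (simp add: geodesic_spray_coeff_def matrix_vector_mult_def b_def Let_def)
  then have "covariant_spray_coeff A c F i z =
      (\<Sum>r\<in>UNIV. ?M $ i $ r * (1/4 * (matrix_inv ?M *v b) $ r))"
    unfolding covariant_spray_coeff_def by (simp only:)
  also have "\<dots> = 1/4 * (?M *v (matrix_inv ?M *v b)) $ i"
    by (simp add: matrix_vector_mult_def[of ?M] sum_divide_distrib)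
  also have "?M *v (matrix_inv ?M *v b) = b"
  proof -
    have "?M ** matrix_inv ?M = mat 1"
      using someI_ex[OF assms[unfolded invertible_def]] unfolding matrix_inv_def by blast
    then show ?thesis by (simp add: matrix_vector_mul_assoc)
  qed
  finally show ?thesis by (simp add: b_def)
qed

lemma spray_scalar_formula:
  assumes M: "smooth_manifold X A" and F: "finsler_metric X A F" and c: "c \<in> A"
    and H: "spray_scalar X A F c H" and z: "(x, y) \<in> slit_coord_domain c"
  shows "coord_rep A c H (x, y) =
    1/12 * (\<Sum>i\<in>UNIV. y $ i * dx i (\<lambda>z. (coord_rep A c F z)\<^sup>2) (x, y))"
proof -
  let ?S = "slit_coord_domain c"
  let ?E = "\<lambda>w. (coord_rep A c F w)\<^sup>2"
  have S: "open ?S" using open_slit_coord_domain[OF is_chart_atlas[OF M c]] .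
  have smF: "smooth_on ?S (coord_rep A c F)"
    using F c unfolding finsler_metric_def smooth_on_slit_def by blast
  have smH: "smooth_on ?S (coord_rep A c H)"
    using H c unfolding spray_scalar_def smooth_on_slit_def by blast
  have "pos_homogeneous 1 (slit_tangent_bundle A (topspace X)) F"
    using F unfolding finsler_metric_def pos_homogeneous_def slit_tangent_bundle_def by fast
  then have homE: "?E (x, r *\<^sub>R y) = r ^ 2 * ?E (x, y)" if "(x, y) \<in> ?S" "r > 0" for x y r
    using coord_rep_homogeneous[OF M c _ that] by (simp add: power_mult_distrib)
  have homH: "coord_rep A c H (x, r *\<^sub>R y) = r ^ 3 * coord_rep A c H (x, y)" if "r > 0" for r
    using coord_rep_homogeneous[OF M c _ z that] H unfolding spray_scalar_def by blast
  have mixed: "(\<Sum>i\<in>UNIV. y $ i * dx r (dy i ?E) (x, y)) = 2 * dx r ?E (x, y)" for r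
    using contracted_mixed_derivative[OF S z differentiable_dy_square(1)[OF S smF]
        differentiable_dy_square(2)[OF S smF z] homE] by simp
  have coeff: "dy i (coord_rep A c H) (x, y) =
      1/4 * ((\<Sum>r\<in>UNIV. y $ r * dx r (dy i ?E) (x, y)) - dx i ?E (x, y))" for i
  proof -
    have "invertible (metric_matrix A c F (x, y))"
      using F c z unfolding finsler_metric_def by blast
    then show ?thesis
      using covariant_spray_coeff_eq[of A c F "(x, y)" i] H z unfolding spray_scalar_def by simp
  qed
  have "3 * coord_rep A c H (x, y) = (\<Sum>i\<in>UNIV. y $ i * dy i (coord_rep A c H) (x, y))"
    using euler_homogeneous[OF smooth_on_differentiable[OF smH z] homH] by simp
  also have "\<dots> = 1/4 * ((\<Sum>i\<in>UNIV. \<Sum>r\<in>UNIV. y $ i * (y $ r * dx r (dy i ?E) (x, y)))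
      - (\<Sum>i\<in>UNIV. y $ i * dx i ?E (x, y)))"
    by (simp add: coeff right_diff_distrib sum_subtractf sum_distrib_left mult_ac
        flip: sum_divide_distrib diff_divide_distrib)
  also have "(\<Sum>i\<in>UNIV. \<Sum>r\<in>UNIV. y $ i * (y $ r * dx r (dy i ?E) (x, y))) =
      (\<Sum>r\<in>UNIV. y $ r * (\<Sum>i\<in>UNIV. y $ i * dx r (dy i ?E) (x, y)))"
    by (subst sum.swap) (simp add: sum_distrib_left mult_ac)
  also have "\<dots> = 2 * (\<Sum>i\<in>UNIV. y $ i * dx i ?E (x, y))"
    by (simp add: mixed sum_distrib_left mult_ac)
  finally show ?thesis by simp
qed

theorem proposition3p5:
  fixes X :: "'m topology"
    and A :: "('m, 'n::finite) chart set"
    and F H :: "'m \<times> ('m, 'n) tangent \<Rightarrow> real"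
    and c :: "('m, 'n) chart"
  assumes "smooth_manifold X A"
    and "finsler_metric X A F"
    and "c \<in> A"
    and "spray_scalar X A F c H"
  shows "(\<forall>w\<in>slit_tangent_bundle A (fst c).
            H w = 1/12 * (\<Sum>i\<in>UNIV. snd (induced_coords c w) $ i *
              dx i (\<lambda>z. (coord_rep A c F z)\<^sup>2) (induced_coords c w))) \<and>
         (\<forall>H\<^sub>1. spray_scalar X A F c H\<^sub>1 \<longrightarrow>
            (\<exists>h :: 'm \<Rightarrow> real. \<forall>(p, v)\<in>slit_tangent_bundle A (fst c). H\<^sub>1 (p, v) - H (p, v) = h p))"
proof (intro conjI ballI allI impI)
  have formula: "K w = 1/12 * (\<Sum>i\<in>UNIV. snd (induced_coords c w) $ i *
      dx i (\<lambda>z. (coord_rep A c F z)\<^sup>2) (induced_coords c w))"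
    if "spray_scalar X A F c K" and "w \<in> slit_tangent_bundle A (fst c)" for K w
    using spray_scalar_formula[OF assms(1-3) that(1), of "fst (induced_coords c w)"
        "snd (induced_coords c w)"] induced_coords_slit[OF assms(1,3) that(2)]
      coord_rep_induced_coords[OF assms(1,3)] by simp
  show "H w = 1/12 * (\<Sum>i\<in>UNIV. snd (induced_coords c w) $ i *
      dx i (\<lambda>z. (coord_rep A c F z)\<^sup>2) (induced_coords c w))"
    if "w \<in> slit_tangent_bundle A (fst c)" for w
    using formula[OF assms(4) that] .
  fix H\<^sub>1 assume H\<^sub>1: "spray_scalar X A F c H\<^sub>1"
  have "\<forall>(p, v)\<in>slit_tangent_bundle A (fst c). H\<^sub>1 (p, v) - H (p, v) = 0"
  proof clarify
    fix p v assume w: "(p, v) \<in> slit_tangent_bundle A (fst c)"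
    show "H\<^sub>1 (p, v) - H (p, v) = 0"
      unfolding formula[OF H\<^sub>1 w] formula[OF assms(4) w] by simp
  qed
  then show "\<exists>h :: 'm \<Rightarrow> real. \<forall>(p, v)\<in>slit_tangent_bundle A (fst c). H\<^sub>1 (p, v) - H (p, v) = h p"
    by (rule exI[of _ "\<lambda>_. 0"])
qed

end
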